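(* For all integers $r\geq2$ and $n\geq1$, the base-$r$ $n$-simplex $\mathcal{B}_{(r,n)}$ has $h^\ast$-polynomial $$h^\ast(\mathcal{B}_{(r,n)};z)=\sum_{b=0}^{r^n-1}z^{\mathrm{nasc}_r(b)}.$$
   Context: For integers $r\geq2$, $n\geq1$, the base-$r$ $n$-simplex is $\mathcal{B}_{(r,n)}:=\mathrm{conv}(e_1,\ldots,e_n,-q)\subset\mathbb{R}^n$, where $e_1,\ldots,e_n$ are the standard basis vectors and $q=((r-1),(r-1)r,(r-1)r^2,\ldots,(r-1)r^{n-1})$. For a $d$-dimensional lattice polytope $P\subset\mathbb{R}^n$, the $h^\ast$-polynomial $h^\ast(P;z)=h_0^\ast+h_1^\ast z+\cdots+h_d^\ast z^d$ is defined by $\sum_{t\geq0}|tP\cap\mathbb{Z}^n|z^t=\frac{h^\ast(P;z)}{(1-z)^{d+1}}$. For an integer $b\geq 0$, let $b_r(i)\in\{0,1,\ldots,r-1\}$ ($i\geq0$) denote its base-$r$ digits, so $b=\sum_{i\geq0}b_r(i)r^i$. The (average weighted) height of an index $i>0$ in the base-$r$ representation of $b$ is $$\mathrm{awheight}(i):=\frac1i\sum_{j=0}^{i-1}(b_r(i)-b_r(j))r^j,$$ and $\mathrm{awheight}(0):=0$ if $b_r(0)=0$, $\mathrm{awheight}(0):=1$ if $b_r(0)\neq0$. Let $\mathrm{Supp}_r(b):=\{i\in\mathbb{Z}_{\geq0}:b_r(i)\neq0\}$, $\mathrm{Nasc}_r(b):=\{i\in\mathrm{Supp}_r(b):0\leq\mathrm{awheight}(i)\}$,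 and $\mathrm{nasc}_r(b):=|\mathrm{Nasc}_r(b)|$. *)

theory Defs
  imports "HOL-Analysis.Analysis" "HOL-Computational_Algebra.Computational_Algebra"
begin

text \<open>
  Ehrhart theory is carried out in \<open>real ^ 'n\<close>. As \<open>'n\<close> carries no order, the numbering
  \<open>1, \<dots>, n\<close> of the coordinates is an explicit parameter \<open>idx :: 'n \<Rightarrow> nat\<close>, to be used
  with \<open>idx\<close> a bijection from \<open>UNIV\<close> onto \<open>{1..n}\<close>, so that \<open>axis i 1\<close> is the standard basis
  vector \<open>e\<close> with subscript \<open>idx i\<close>.
\<close>

definition base_simplex_q :: "nat \<Rightarrow> ('n::finite \<Rightarrow> nat) \<Rightarrow> real ^ 'n" where
  "base_simplex_q r idx = (\<chi> i. (real r - 1) * real r ^ (idx i - 1))"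

definition base_simplex :: "nat \<Rightarrow> ('n::finite \<Rightarrow> nat) \<Rightarrow> (real ^ 'n) set" where
  "base_simplex r idx =
     convex hull (insert (- base_simplex_q r idx) (range (\<lambda>i. axis i 1)))"

definition integer_points :: "(real ^ 'n::finite) set" where
  "integer_points = {x. \<forall>i. x $ i \<in> \<int>}"

definition ehrhart_series :: "(real ^ 'n::finite) set \<Rightarrow> real fps" where
  "ehrhart_series P =
     Abs_fps (\<lambda>t. real (card ((\<lambda>x. real t *\<^sub>R x) ` P \<inter> integer_points)))"

text \<open>
  The quotient is taken in the ring of formal power series, where \<open>1 - fps_X\<close> is a unit. The
  description is thus satisfied by at most one polynomial (see \<open>hstar_poly_eqI\<close>), and it is
  meaningful when \<open>P\<close> is a lattice polytope, for which one exists. The dimension \<open>d\<close> is the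
  affine dimension of \<open>P\<close>.
\<close>

definition hstar_poly :: "(real ^ 'n::finite) set \<Rightarrow> real poly" where
  "hstar_poly P =
     (THE h. degree h \<le> nat (aff_dim P) \<and>
        ehrhart_series P = fps_of_poly h / (1 - fps_X) ^ (nat (aff_dim P) + 1))"

lemma hstar_poly_eqI:
  assumes "degree h \<le> nat (aff_dim P)"
    and "ehrhart_series P = fps_of_poly h / (1 - fps_X) ^ (nat (aff_dim P) + 1)"
  shows "hstar_poly P = h"
  unfolding hstar_poly_def
proof (rule the_equality)
  let ?u = "(1 - fps_X :: real fps) ^ (nat (aff_dim P) + 1)"
  have u: "?u dvd 1"
    by (simp add: fps_is_unit_iff)
  fix g assume "degree g \<le> nat (aff_dim P) \<and> ehrhart_series P = fps_of_poly g / ?u"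
  then have "fps_of_poly g / ?u = fps_of_poly h / ?u"
    using assms(2) by simp
  then have "fps_of_poly g = fps_of_poly h"
    using u by (metis dvd_div_mult_self dvd_trans one_dvd)
  then show "g = h" by simp
qed (use assms in auto)

definition base_digit :: "nat \<Rightarrow> nat \<Rightarrow> nat \<Rightarrow> nat" where
  "base_digit r b i = b div r ^ i mod r"

definition awheight :: "nat \<Rightarrow> nat \<Rightarrow> nat \<Rightarrow> real" where
  "awheight r b i =
     (if i = 0 then (if base_digit r b 0 = 0 then 0 else 1)
      else 1 / real i *
        (\<Sum>j = 0..i - 1. (real (base_digit r b i) - real (base_digit r b j)) * real r ^ j))"

definition Supp :: "nat \<Rightarrow> nat \<Rightarrow> nat set" where
  "Supp r b = {i. base_digit r b i \<noteq> 0}"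

definition Nasc :: "nat \<Rightarrow> nat \<Rightarrow> nat set" where
  "Nasc r b = {i \<in> Supp r b. 0 \<le> awheight r b i}"

definition nasc :: "nat \<Rightarrow> nat \<Rightarrow> nat" where
  "nasc r b = card (Nasc r b)"

end

theory Submission
  imports Defs
begin

text \<open>
  For a vector \<open>q\<close> of natural numbers and \<open>N = 1 + \<Sum>i. q i\<close>, a lattice point \<open>x\<close> lies in the
  \<open>t\<close>-th dilate of \<open>conv (e\<^sub>1, \<dots>, e\<^sub>n, -q)\<close> iff \<open>m = t - \<Sum>i. x i\<close> is nonnegative and
  \<open>x i + \<lfloor>m q i / N\<rfloor> \<ge> 0\<close> for all \<open>i\<close>. Writing \<open>m = b + k N\<close> with \<open>b < N\<close>, such points
  correspond to a residue \<open>b\<close> and \<open>n + 1\<close> free natural numbers, namely \<open>k\<close> and the slacks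
  \<open>x i + \<lfloor>m q i / N\<rfloor>\<close>, with sum \<open>t - w b\<close>, where \<open>w b = b - (\<Sum>i. \<lfloor>b q i / N\<rfloor>)\<close>. Hence
  \<open>h\<^sup>*\<close> is the sum of \<open>z\<close> to the power \<open>w b\<close> over all \<open>b < N\<close>. In base \<open>r\<close>, the number
  \<open>\<lfloor>b (r - 1) / r\<^sup>j\<^sup>+\<^sup>1\<rfloor>\<close> falls short of \<open>\<lfloor>b / r\<^sup>j\<rfloor> - \<lfloor>b / r\<^sup>j\<^sup>+\<^sup>1\<rfloor>\<close> by one if \<open>j\<close> is a
  nonascent and by zero otherwise, so the sum defining \<open>w b\<close> telescopes to the number of nonascents.
\<close>

section \<open>Digits and nonascents\<close>

text \<open>With \<open>b = (B * r + d) * r ^ j + R\<close> one gets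
  \<open>b * (r - 1) = e + (B * (r - 1) + d) * r ^ Suc j\<close>, where
  \<open>e = (r - 1) * R - d * r ^ j\<close> has absolute value below \<open>r ^ Suc j\<close>. The
  quotient is thus off by one exactly when \<open>e < 0\<close>. The additive form avoids truncated
  subtraction.\<close>

lemma div_power_diff_eq:
  fixes r b j :: nat
  assumes "r \<ge> 2"
  shows "b * (r - 1) div r ^ Suc j
           + of_bool ((r - 1) * (b mod r ^ j) < base_digit r b j * r ^ j)
           + b div r ^ Suc j = b div r ^ j"
proof -
  define B d R where "B = b div r ^ Suc j" and "d = base_digit r b j" and "R = b mod r ^ j"
  define M where "M = int r ^ Suc j"
  have Mpos: "M > 0" using assms by (simp add: M_def)
  have Bd: "b div r ^ j = B * r + d"
    unfolding B_def d_def base_digit_def power_Suc2 div_mult2_eq by simp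
  have b: "b = (B * r + d) * r ^ j + R"
    unfolding R_def Bd[symmetric] by (rule div_mult_mod_eq[symmetric])
  have d: "d < r" using assms by (simp add: d_def base_digit_def)
  have R: "R < r ^ j" using assms by (simp add: R_def)
  have rj: "int r ^ j \<ge> 1" using assms by simp
  define e where "e = (int r - 1) * int R - int d * int r ^ j"
  have eq: "int (b * (r - 1)) = e + (int B * (int r - 1) + int d) * M"
  proof -
    have r1: "int (r - 1) = int r - 1" using assms by simp
    then show ?thesis
      unfolding of_nat_mult r1 by (simp add: b e_def M_def algebra_simps del: of_nat_diff)
  qed
  have "int d * int r ^ j < M"
    using d rj by (simp add: M_def)
  moreover have "(int r - 1) * int R \<ge> 0"
    using assms by simp
  ultimately have e1: "- M < e" by (simp add: e_def)
  have "int R < int r ^ j"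
    using R by (metis of_nat_less_iff of_nat_power)
  then have "(int r - 1) * int R \<le> (int r - 1) * int r ^ j"
    using assms by (intro mult_left_mono) auto
  also have "\<dots> < M" using assms by (simp add: M_def algebra_simps)
  finally have "(int r - 1) * int R < M" .
  moreover have "0 \<le> int d * int r ^ j" by simp
  ultimately have e2: "e < M" unfolding e_def by linarith
  have "e div M = - of_bool (e < 0)"
  proof (cases "e < 0")
    case True
    then have "e div M = -1"
      using e1 Mpos by (intro int_div_pos_eq[where r = "e + M"]) auto
    with True show ?thesis by simp
  qed (use e2 in auto)
  then have "int (b * (r - 1)) div M = int B * (int r - 1) + int d - of_bool (e < 0)"
    using Mpos by (simp only: eq div_mult_self1)
  moreover have "e < 0 \<longleftrightarrow> (r - 1) * R < d * r ^ j"
  proof -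
    have "e < 0 \<longleftrightarrow> int ((r - 1) * R) < int (d * r ^ j)"
      using assms by (simp add: e_def of_nat_diff)
    then show ?thesis by (simp only: of_nat_less_iff)
  qed
  ultimately have "int (b * (r - 1) div r ^ Suc j)
      = int B * (int r - 1) + int d - of_bool ((r - 1) * R < d * r ^ j)"
    by (simp add: zdiv_int M_def)
  then have "int (b * (r - 1) div r ^ Suc j + of_bool ((r - 1) * R < d * r ^ j) + B)
      = int (B * r + d)"
    by (simp add: algebra_simps)
  then show ?thesis
    unfolding Bd B_def[symmetric] d_def[symmetric] R_def[symmetric] by (simp only: of_nat_eq_iff)
qed

lemma sum_digits_eq_mod: "(\<Sum>j<i. base_digit r b j * r ^ j) = b mod r ^ i"
proof (induction i)
  case (Suc i)
  then show ?case
    by (simp add: base_digit_def mod_mult2_eq[of b "r ^ i" r, folded power_Suc2] algebra_simps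
        del: power_Suc)
qed simp

text \<open>For \<open>i > 0\<close> a nonnegative height means \<open>R \<le> d * S\<close> with
  \<open>S\<close> the geometric sum. Multiplying by \<open>r - 1\<close> turns \<open>S\<close>
  into \<open>r ^ i - 1\<close> and yields the correction condition of
  \<open>div_power_diff_eq\<close>. For \<open>i = 0\<close> the height is never negative and
  \<open>b mod 1 = 0\<close>, so both sides say that the digit is nonzero.\<close>

lemma Nasc_iff:
  assumes "r \<ge> 2"
  shows "i \<in> Nasc r b \<longleftrightarrow> (r - 1) * (b mod r ^ i) < base_digit r b i * r ^ i"
proof (cases "i = 0")
  case True
  then show ?thesis by (simp add: Nasc_def Supp_def awheight_def)
next
  case False
  define d R S where "d = base_digit r b i" and "R = b mod r ^ i" and "S = (\<Sum>j<i. r ^ j)"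
  have S: "int (r - 1) * int S = int r ^ i - 1"
    using power_diff_1_eq[of "int r" i] assms by (simp add: S_def of_nat_diff)
  have d: "int d \<le> int (r - 1)"
    using assms by (simp add: d_def base_digit_def less_Suc_eq_le[symmetric])
  have "(\<Sum>j = 0..i - 1. (real d - real (base_digit r b j)) * real r ^ j)
      = real d * (\<Sum>j<i. real r ^ j) - (\<Sum>j<i. real (base_digit r b j) * real r ^ j)"
    using False by (simp add: atLeast0AtMost lessThan_Suc_atMost[symmetric] sum_subtractf
        sum_distrib_left algebra_simps)
  also have "\<dots> = real (d * S) - real R"
    by (simp add: S_def R_def flip: sum_digits_eq_mod)
  finally have "0 \<le> awheight r b i \<longleftrightarrow> R \<le> d * S"
    using False by (simp add: awheight_def zero_le_divide_iff flip: d_def of_nat_mult)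
  then have "i \<in> Nasc r b \<longleftrightarrow> d \<noteq> 0 \<and> int R \<le> int d * int S"
    by (simp add: Nasc_def Supp_def d_def flip: of_nat_mult)
  also have "\<dots> \<longleftrightarrow> int (r - 1) * int R < int d * int r ^ i"
  proof -
    \<comment> \<open>The right side exceeds a multiple of \<open>r - 1\<close> by \<open>d\<close>.
      The bound \<open>d \<le> r - 1\<close> allows rounding the strict inequality down to that
      multiple, and \<open>d > 0\<close> gives strictness in the converse.\<close>
    have *: "int d * int r ^ i = int (r - 1) * (int d * int S) + int d"
      using arg_cong[OF S, of "(*) (int d)"] by (simp only: right_diff_distrib mult.left_commute mult_1_right)
    have pos: "int (r - 1) > 0" using assms by simp
    show ?thesis
    proof (intro iffI conjI)
      assume A: "int (r - 1) * int R < int d * int r ^ i"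
      have "0 \<le> int (r - 1) * int R" by simp
      with A have "0 < int d * int r ^ i" by linarith
      then show "d \<noteq> 0" by (intro notI) simp
      have "int (r - 1) * int R < int (r - 1) * (int d * int S + 1)"
        using A d unfolding * distrib_left mult_1_right by linarith
      then show "int R \<le> int d * int S"
        using pos by (simp only: mult_less_cancel_left_pos)
    next
      assume A: "d \<noteq> 0 \<and> int R \<le> int d * int S"
      then have "int (r - 1) * int R \<le> int (r - 1) * (int d * int S)"
        by (intro mult_left_mono) auto
      with A show "int (r - 1) * int R < int d * int r ^ i" unfolding * by linarith
    qed
  qed
  also have "\<dots> \<longleftrightarrow> (r - 1) * R < d * r ^ i"
    by (simp only: of_nat_less_iff flip: of_nat_power of_nat_mult)
  finally show ?thesis by (simp add: d_def R_def)
qed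

text \<open>Digits from position \<open>n\<close> on vanish. This lets the telescoping sum stop at
  \<open>n\<close> and later bounds the degree.\<close>

lemma Nasc_subset:
  assumes "r \<ge> 2" and "b < r ^ n"
  shows "Nasc r b \<subseteq> {..<n}"
proof
  fix i assume "i \<in> Nasc r b"
  then have "b div r ^ i \<noteq> 0"
    by (intro notI) (simp add: Nasc_def Supp_def base_digit_def del: div_eq_0_iff)
  then have "r ^ i < r ^ n"
    using assms(2) by (metis div_less linorder_not_less order_le_less_trans)
  then show "i \<in> {..<n}"
    using assms(1) by simp
qed

lemma sum_div_power_plus_nasc:
  assumes "r \<ge> 2" and "b < r ^ n"
  shows "(\<Sum>j<n. b * (r - 1) div r ^ Suc j) + nasc r b = b"
proof -
  \<comment> \<open>Keeping the remaining term \<open>b div r ^ k\<close> makes the telescoping an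
    induction on \<open>k\<close>; at \<open>k = n\<close> this term is 0.\<close>
  have "(\<Sum>j<k. b * (r - 1) div r ^ Suc j + of_bool (j \<in> Nasc r b)) + b div r ^ k = b" for k
  proof (induction k)
    case (Suc k)
    then show ?case
      using div_power_diff_eq[OF assms(1), of b k] by (simp add: Nasc_iff[OF assms(1)])
  qed simp
  from this[of n] have "(\<Sum>j<n. b * (r - 1) div r ^ Suc j)
      + (\<Sum>j<n. of_bool (j \<in> Nasc r b)) = b"
    using assms(2) by (simp add: sum.distrib)
  moreover have "{..<n} \<inter> {j. j \<in> Nasc r b} = Nasc r b"
    using Nasc_subset[OF assms] by auto
  ultimately show ?thesis by (simp add: nasc_def)
qed

section \<open>Counting weak compositions\<close>

text \<open>Values outside \<open>A\<close> are fixed to 0, so that a function is determined by its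
  values on \<open>A\<close> and the sets can be counted.\<close>

definition weak_compositions :: "'a set \<Rightarrow> nat \<Rightarrow> ('a \<Rightarrow> nat) set" where
  "weak_compositions A s = {f. (\<forall>x. x \<notin> A \<longrightarrow> f x = 0) \<and> sum f A = s}"

lemma finite_weak_compositions:
  assumes "finite A"
  shows "finite (weak_compositions A s)"
proof (rule finite_subset)
  show "weak_compositions A s \<subseteq> {f. \<forall>x. (x \<in> A \<longrightarrow> f x \<in> {..s}) \<and> (x \<notin> A \<longrightarrow> f x = 0)}"
    using assms by (auto simp: weak_compositions_def intro: member_le_sum)
  show "finite {f. \<forall>x. (x \<in> A \<longrightarrow> f x \<in> {..s}) \<and> (x \<notin> A \<longrightarrow> f x = 0)}"
    using assms by (intro finite_set_of_finite_funs) auto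
qed

text \<open>Pascal's rule: either \<open>f a = 0\<close>, or \<open>f a\<close> can be lowered by
  one.\<close>

lemma card_weak_compositions_insert:
  assumes "finite A" "a \<notin> A"
  shows "card (weak_compositions (insert a A) (Suc s))
       = card (weak_compositions A (Suc s)) + card (weak_compositions (insert a A) s)"
proof -
  let ?inc = "\<lambda>f. f(a := Suc (f a))"
  have sum_upd: "sum (f(a := y)) A = sum f A" for f :: "'a \<Rightarrow> nat" and y
    using assms by (intro sum.cong) auto
  have "weak_compositions (insert a A) (Suc s)
      = weak_compositions A (Suc s) \<union> ?inc ` weak_compositions (insert a A) s" (is "?L = ?R")
  proof
    show "?L \<subseteq> ?R"
    proof
      fix f assume f: "f \<in> ?L"
      show "f \<in> ?R"
      proof (cases "f a")
        case 0
        then have "f \<in> weak_compositions A (Suc s)"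
            using f assms by (auto simp: weak_compositions_def) (metis)
          then show ?thesis by blast
      next
        case (Suc k)
        have "f(a := k) \<in> weak_compositions (insert a A) s"
          using f assms Suc by (auto simp: weak_compositions_def sum_upd cong del: sum.cong_simp)
        moreover have "f = ?inc (f(a := k))" using Suc by auto
        ultimately show ?thesis by blast
      qed
    qed
    show "?R \<subseteq> ?L"
      using assms by (auto simp: weak_compositions_def sum_upd cong del: sum.cong_simp)
  qed
  moreover have "weak_compositions A (Suc s) \<inter> ?inc ` weak_compositions (insert a A) s = {}"
    using assms by (auto simp: weak_compositions_def)
  moreover have "inj_on ?inc (weak_compositions (insert a A) s)"
    by (rule inj_onI) (metis fun_upd_same fun_upd_triv fun_upd_upd nat.inject)
  ultimately show ?thesis
    using assms by (simp add: card_Un_disjoint finite_weak_compositions card_image)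
qed

text \<open>By the preceding recurrence, multiplication by \<open>1 - fps_X\<close> removes one
  element from the index set. The product form makes sense over any commutative ring.\<close>

lemma fps_weak_compositions:
  assumes "finite A"
  shows "Abs_fps (\<lambda>s. of_nat (card (weak_compositions A s))) * (1 - fps_X) ^ card A
       = (1 :: 'b::comm_ring_1 fps)"
  using assms
proof induction
  case empty
  have "weak_compositions {} s = (if s = 0 then {\<lambda>_::'a. 0} else {})" for s
    by (auto simp: weak_compositions_def)
  then show ?case by (simp add: fps_eq_iff)
next
  case (insert a A)
  let ?G = "\<lambda>A. Abs_fps (\<lambda>s. of_nat (card (weak_compositions A s))) :: 'b fps"
  have "?G (insert a A) * (1 - fps_X) = ?G A"
  proof (rule fps_ext)
    fix s
    show "(?G (insert a A) * (1 - fps_X)) $ s = ?G A $ s"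
    proof (cases s)
      case 0
      have "weak_compositions (insert a A) 0 = weak_compositions A 0"
        using insert by (auto simp: weak_compositions_def) metis
      with 0 show ?thesis by simp
    next
      case (Suc k)
      then show ?thesis
        using card_weak_compositions_insert[OF insert(1,2), of k] by (simp add: algebra_simps)
    qed
  qed
  then have "?G (insert a A) * ((1 - fps_X) * (1 - fps_X) ^ card A) = 1"
    by (simp add: insert.IH flip: mult.assoc)
  with insert show ?case by simp
qed

section \<open>The simplex of a weight vector\<close>

text \<open>The weights are the coefficients in the relation expressing \<open>0\<close> by the
  vertices: \<open>-q\<close> has weight 1 and \<open>axis i 1\<close> has weight
  \<open>q i\<close>. The counting below works for every \<open>q\<close>; base \<open>r\<close>
  enters only at the end.\<close>

definition weight_simplex :: "('n::finite \<Rightarrow> nat) \<Rightarrow> (real ^ 'n) set" where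
  "weight_simplex q = convex hull (insert (- (\<chi> i. real (q i))) (range (\<lambda>i. axis i 1)))"

lemma sum_axis: "(\<Sum>j\<in>UNIV. axis i (1::real) $ j) = 1"
  by (simp add: axis_def)

text \<open>The inequalities say that the barycentric coordinates are nonnegative. If
  \<open>-q\<close> has coefficient \<open>c\<close>, the coordinates of \<open>x\<close> sum to
  \<open>1 - c * N\<close>, which determines \<open>c\<close> and then the coefficients of the unit
  vectors.\<close>

lemma weight_simplex_iff:
  fixes q :: "'n::finite \<Rightarrow> nat"
  defines "N \<equiv> 1 + (\<Sum>i\<in>UNIV. q i)"
  shows "x \<in> weight_simplex q \<longleftrightarrow> 0 \<le> 1 - (\<Sum>i\<in>UNIV. x $ i)
           \<and> (\<forall>i. 0 \<le> x $ i + (1 - (\<Sum>i\<in>UNIV. x $ i)) * real (q i) / real N)"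
    (is "_ \<longleftrightarrow> ?H x")
proof
  have N: "real N = 1 + (\<Sum>i\<in>UNIV. real (q i))" "real N > 0"
    by (simp_all add: N_def add_pos_nonneg sum_nonneg)
  {
    assume "x \<in> weight_simplex q"
    moreover have "weight_simplex q \<subseteq> Collect ?H"
      unfolding weight_simplex_def
    proof (rule hull_minimal)
      show "insert (- (\<chi> i. real (q i))) (range (\<lambda>i. axis i 1)) \<subseteq> Collect ?H"
        using N by (auto simp: sum_axis sum_negf axis_def)
      show "convex (Collect ?H)"
      proof (rule convexI, simp only: mem_Collect_eq, intro conjI allI)
        fix x y :: "real ^ 'n" and u v :: real and i
        assume x: "?H x" and y: "?H y" and uv: "0 \<le> u" "0 \<le> v" "u + v = 1"
        let ?s = "\<lambda>x :: real ^ 'n. 1 - (\<Sum>i\<in>UNIV. x $ i)"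
        have s: "?s (u *\<^sub>R x + v *\<^sub>R y) = u * ?s x + v * ?s y"
          using uv(3) by (simp add: sum.distrib algebra_simps flip: sum_distrib_left)
        show "0 \<le> ?s (u *\<^sub>R x + v *\<^sub>R y)"
          unfolding s using x y uv by simp
        have "(u *\<^sub>R x + v *\<^sub>R y) $ i + ?s (u *\<^sub>R x + v *\<^sub>R y) * real (q i) / real N
            = u * (x $ i + ?s x * real (q i) / real N) + v * (y $ i + ?s y * real (q i) / real N)"
          unfolding s by (simp add: algebra_simps add_divide_distrib diff_divide_distrib)
        also have "0 \<le> \<dots>"
          using x y mult_nonneg_nonneg[OF uv(1)] mult_nonneg_nonneg[OF uv(2)]
          by (intro add_nonneg_nonneg[of "u * _" "v * _"]) blast+
        finally show "0 \<le> (u *\<^sub>R x + v *\<^sub>R y) $ i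
            + ?s (u *\<^sub>R x + v *\<^sub>R y) * real (q i) / real N" .
      qed
    qed
    ultimately show "?H x" by blast
  }
  assume H: "?H x"
  define m where "m = 1 - (\<Sum>i\<in>UNIV. x $ i)"
  \<comment> \<open>These are the barycentric coordinates: \<open>None\<close> stands for the vertex
    \<open>-q\<close>, \<open>Some i\<close> for \<open>axis i 1\<close>.\<close>
  define c where "c = case_option (m / real N) (\<lambda>i. x $ i + m * real (q i) / real N)"
  define v where "v = case_option (- (\<chi> i. real (q i))) (\<lambda>i::'n. axis i (1::real))"
  have UN: "(UNIV :: 'n option set) = insert None (range Some)"
    by (auto simp: UNIV_option_conv)
  have split: "(\<Sum>k\<in>UNIV. g k) = g None + (\<Sum>i\<in>UNIV. g (Some i))"
    for g :: "'n option \<Rightarrow> 'z::comm_monoid_add"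
    by (simp add: UN sum.reindex)
  have "(\<Sum>k\<in>UNIV. c k) = m / real N * (1 + (\<Sum>i\<in>UNIV. real (q i))) + (\<Sum>i\<in>UNIV. x $ i)"
    by (simp add: split c_def sum.distrib algebra_simps
        flip: sum_distrib_left sum_distrib_right sum_divide_distrib)
  also have "\<dots> = 1" using N by (simp add: m_def)
  finally have c1: "(\<Sum>k\<in>UNIV. c k) = 1" .
  have "(\<Sum>k\<in>UNIV. c k *\<^sub>R v k) \<in> weight_simplex q"
  proof (rule convex_sum)
    show "convex (weight_simplex q)" by (simp add: weight_simplex_def)
    show "0 \<le> c k" for k using H N by (cases k) (auto simp: c_def m_def)
    show "v k \<in> weight_simplex q" for k
      by (cases k) (auto simp: v_def weight_simplex_def intro!: hull_inc)
  qed (use c1 in auto)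
  also have "(\<Sum>k\<in>UNIV. c k *\<^sub>R v k) = x"
  proof (rule vec_eq_iff[THEN iffD2], rule allI)
    fix j
    have "(\<Sum>k\<in>UNIV. c k *\<^sub>R v k) $ j
        = - (m / real N * real (q j)) + (\<Sum>i\<in>UNIV. c (Some i) * axis i 1 $ j)"
      by (simp add: split) (simp add: c_def v_def)
    also have "(\<Sum>i\<in>UNIV. c (Some i) * axis i 1 $ j) = c (Some j)"
      by (simp add: axis_def if_distrib cong: if_cong)
    finally show "(\<Sum>k\<in>UNIV. c k *\<^sub>R v k) $ j = x $ j" by (simp add: c_def)
  qed
  finally show "x \<in> weight_simplex q" .
qed

text \<open>For \<open>t > 0\<close> this is a rescaling of \<open>weight_simplex_iff\<close>. For
  \<open>t = 0\<close> the dilate is the origin alone, and the inequalities must be shown to force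
  \<open>x = 0\<close>.\<close>

lemma scaled_weight_simplex_iff:
  fixes q :: "'n::finite \<Rightarrow> nat"
  assumes "t \<ge> 0"
  defines "N \<equiv> 1 + (\<Sum>i\<in>UNIV. q i)"
  shows "x \<in> (\<lambda>x. t *\<^sub>R x) ` weight_simplex q \<longleftrightarrow> 0 \<le> t - (\<Sum>i\<in>UNIV. x $ i)
           \<and> (\<forall>i. 0 \<le> x $ i + (t - (\<Sum>i\<in>UNIV. x $ i)) * real (q i) / real N)"
proof (cases "t = 0")
  case True
  let ?m = "- (\<Sum>i\<in>UNIV. x $ i)"
  have N: "real N = 1 + (\<Sum>i\<in>UNIV. real (q i))" "real N > 0"
    by (simp_all add: N_def add_pos_nonneg sum_nonneg)
  have "x = 0" if m: "0 \<le> ?m" and x: "\<And>i. 0 \<le> x $ i + ?m * real (q i) / real N"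
  proof -
    \<comment> \<open>Adding up the inequalities gives \<open>- ?m / N \<ge> 0\<close>, hence
      \<open>?m = 0\<close>; then the coordinates are nonnegative with sum 0.\<close>
    have "0 \<le> (\<Sum>i\<in>UNIV. x $ i + ?m * real (q i) / real N)"
      using x by (intro sum_nonneg) auto
    also have "\<dots> = - ?m + ?m * (real N - 1) / real N"
      by (simp only: N(1) sum.distrib sum_distrib_left[symmetric] sum_divide_distrib[symmetric]
          minus_minus add_diff_cancel_left')
    also have "\<dots> = - ?m / real N"
      using N(2) by (simp add: field_simps)
    finally have m0: "?m = 0" using m N(2) by (simp add: divide_simps split: if_splits)
    then have "\<forall>i\<in>UNIV. x $ i = 0"
      using x by (subst sum_nonneg_eq_0_iff[symmetric]) auto
    then show "x = 0" by (simp add: vec_eq_iff)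
  qed
  moreover have "weight_simplex q \<noteq> {}" by (simp add: weight_simplex_def)
  ultimately show ?thesis using True by (auto simp: image_constant_conv)
next
  case False
  with assms have t: "t > 0" by simp
  have "x \<in> (\<lambda>x. t *\<^sub>R x) ` weight_simplex q \<longleftrightarrow> (1 / t) *\<^sub>R x \<in> weight_simplex q"
    using t by (auto intro!: image_eqI[where x = "(1 / t) *\<^sub>R x"])
  also have "\<dots> \<longleftrightarrow> 0 \<le> (t - (\<Sum>i\<in>UNIV. x $ i)) / t
      \<and> (\<forall>i. 0 \<le> (x $ i + (t - (\<Sum>i\<in>UNIV. x $ i)) * real (q i) / real N) / t)"
  proof -
    have "1 - (\<Sum>i\<in>UNIV. ((1 / t) *\<^sub>R x) $ i) = (t - (\<Sum>i\<in>UNIV. x $ i)) / t"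
      using t by (simp add: diff_divide_distrib flip: sum_divide_distrib)
    then show ?thesis
      unfolding weight_simplex_iff N_def[symmetric] by (simp add: add_divide_distrib mult.commute)
  qed
  also have "\<dots> \<longleftrightarrow> 0 \<le> t - (\<Sum>i\<in>UNIV. x $ i)
      \<and> (\<forall>i. 0 \<le> x $ i + (t - (\<Sum>i\<in>UNIV. x $ i)) * real (q i) / real N)"
    using t by (simp add: zero_le_divide_iff)
  finally show ?thesis .
qed

text \<open>The simplex contains the origin, so its affine dimension is its linear one, and it
  contains the standard basis.\<close>

lemma aff_dim_weight_simplex:
  fixes q :: "'n::finite \<Rightarrow> nat"
  shows "aff_dim (weight_simplex q) = int CARD('n)"
proof -
  have "0 \<in> weight_simplex q" by (simp add: weight_simplex_iff sum_nonneg add_nonneg_nonneg)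
  then have "aff_dim (weight_simplex q) = int (dim (weight_simplex q))"
    by (intro aff_dim_zero hull_inc)
  moreover have "axis i 1 \<in> weight_simplex q" for i
    by (simp add: weight_simplex_def hull_inc)
  then have "Basis \<subseteq> weight_simplex q"
    by (auto simp: Basis_vec_def)
  then have "dim (Basis :: (real ^ 'n) set) \<le> dim (weight_simplex q)"
    by (rule dim_subset)
  ultimately show ?thesis
    using dim_subset_UNIV[of "weight_simplex q"] by (simp add: dim_eq_card_independent[OF independent_Basis])
qed

section \<open>Lattice points of the dilates and the h-star polynomial\<close>

lemma card_lattice_points_weight_simplex:
  fixes q :: "'n::finite \<Rightarrow> nat"
  defines "N \<equiv> 1 + (\<Sum>i\<in>UNIV. q i)"
  assumes w: "\<And>b. b < N \<Longrightarrow> (\<Sum>i\<in>UNIV. b * q i div N) + w b = b"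
  shows "card ((\<lambda>x. real t *\<^sub>R x) ` weight_simplex q \<inter> integer_points)
       = (\<Sum>b<N. if w b \<le> t then card (weak_compositions (UNIV :: 'n option set) (t - w b)) else 0)"
proof -
  have N: "N > 0" by (simp add: N_def)
  note dilate = scaled_weight_simplex_iff[of "real t" _ q, folded N_def, OF of_nat_0_le_iff]
  have split: "(\<Sum>k\<in>UNIV. g k) = g None + (\<Sum>i\<in>UNIV. g (Some i))" for g :: "'n option \<Rightarrow> nat"
    by (simp add: UNIV_option_conv sum.reindex)
  \<comment> \<open>Adding \<open>k * N\<close> to \<open>b\<close> raises the floor at
    \<open>i\<close> by \<open>k * q i\<close>, in total by \<open>k * (N - 1)\<close>. So
    \<open>m\<close> minus its floors grows only by \<open>k\<close>, which is why \<open>k\<close>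
    acts as one more free summand.\<close>
  have floors: "(\<Sum>i\<in>UNIV. (b + k * N) * q i div N) + w b + k = b + k * N" if "b < N" for b k
  proof -
    have "(b + k * N) * q i div N = b * q i div N + k * q i" for i
      using N by (simp add: add_mult_distrib mult.assoc mult.left_commute[of k N])
    then have "(\<Sum>i\<in>UNIV. (b + k * N) * q i div N)
        = (\<Sum>i\<in>UNIV. b * q i div N) + k * (\<Sum>i\<in>UNIV. q i)"
      by (simp add: sum.distrib flip: sum_distrib_left)
    then have "(\<Sum>i\<in>UNIV. (b + k * N) * q i div N) + w b + k
        = ((\<Sum>i\<in>UNIV. b * q i div N) + w b) + k * N"
      by (simp add: N_def)
    with w[OF that] show ?thesis by simp
  qed
  define C where "C = (SIGMA b:{..<N}. {f :: 'n option \<Rightarrow> nat. w b + sum f UNIV = t})"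
  \<comment> \<open>In a pair \<open>(b, f)\<close>, \<open>f None\<close> is the quotient
    \<open>k\<close> and \<open>f (Some i)\<close> the slack at \<open>i\<close>; solving the slack
    for the coordinate gives \<open>\<Phi>\<close>.\<close>
  define \<Phi> :: "nat \<times> ('n option \<Rightarrow> nat) \<Rightarrow> real ^ 'n" where
    "\<Phi> = (\<lambda>(b, f). \<chi> i. real (f (Some i)) - real ((b + f None * N) * q i div N))"
  \<comment> \<open>The point determines \<open>m = b + f None * N\<close>, hence \<open>b\<close>
    and \<open>f None\<close> by division by \<open>N\<close>; injectivity rests on this.\<close>
  have sum_\<Phi>: "(\<Sum>i\<in>UNIV. \<Phi> (b, f) $ i) = real t - real (b + f None * N)"
    if "(b, f) \<in> C" for b f
  proof -
    have "b < N" and t: "w b + (f None + (\<Sum>i\<in>UNIV. f (Some i))) = t"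
      using that by (auto simp: C_def split)
    have "(\<Sum>i\<in>UNIV. \<Phi> (b, f) $ i) = real (\<Sum>i\<in>UNIV. f (Some i))
        - real (\<Sum>i\<in>UNIV. (b + f None * N) * q i div N)"
      by (simp add: \<Phi>_def sum_subtractf)
    then show ?thesis
      unfolding t[symmetric] using floors[OF \<open>b < N\<close>, of "f None", THEN arg_cong[of _ _ real]]
      by (simp del: of_nat_sum of_nat_mult)
  qed
  have inj: "inj_on \<Phi> C"
  proof (rule inj_onI, clarify)
    fix b f b' f' assume C: "(b, f) \<in> C" "(b', f') \<in> C" and eq: "\<Phi> (b, f) = \<Phi> (b', f')"
    have "real (b + f None * N) = real (b' + f' None * N)"
      using sum_\<Phi>[OF C(1)] sum_\<Phi>[OF C(2)] eq by simp
    then have m: "b + f None * N = b' + f' None * N" by (simp only: of_nat_eq_iff)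
    moreover have "b < N" "b' < N" using C by (auto simp: C_def)
    ultimately have b: "b = b'"
      by (metis mod_less mod_mult_self1)
    with m N have k: "f None = f' None" by simp
    have "f (Some i) = f' (Some i)" for i
      using eq[THEN arg_cong[of _ _ "\<lambda>x. x $ i"]] by (simp add: \<Phi>_def b k)
    with b k show "b = b' \<and> f = f'"
      by (auto intro!: ext) (metis option.exhaust)
  qed
  have "(\<lambda>x. real t *\<^sub>R x) ` weight_simplex q \<inter> integer_points = \<Phi> ` C"
  proof (intro equalityI subsetI)
    fix x assume "x \<in> \<Phi> ` C"
    then obtain b f where bf: "(b, f) \<in> C" and x: "x = \<Phi> (b, f)" by auto
    let ?m = "b + f None * N"
    have "0 \<le> x $ i + real ?m * real (q i) / real N" for i
    proof -
      have "real (?m * q i div N) \<le> real (?m * q i) / real N"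
        by (rule of_nat_div_le_of_nat)
      then show ?thesis by (simp add: x \<Phi>_def)
    qed
    then have "x \<in> (\<lambda>x. real t *\<^sub>R x) ` weight_simplex q"
      using sum_\<Phi>[OF bf] by (simp add: dilate x del: of_nat_add of_nat_mult)
    moreover have "x \<in> integer_points"
      by (simp add: x \<Phi>_def integer_points_def)
    ultimately show "x \<in> (\<lambda>x. real t *\<^sub>R x) ` weight_simplex q \<inter> integer_points" by blast
  next
    fix x assume x: "x \<in> (\<lambda>x. real t *\<^sub>R x) ` weight_simplex q \<inter> integer_points"
    then have "\<forall>i. \<exists>z. x $ i = of_int z"
      by (auto simp: integer_points_def elim!: Ints_cases)
    then obtain z where z: "\<And>i. x $ i = of_int (z i)" by metis
    have sx: "real t - (\<Sum>i\<in>UNIV. x $ i) = of_int (int t - (\<Sum>i\<in>UNIV. z i))"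
      by (simp add: z)
    have H: "0 \<le> real t - (\<Sum>i\<in>UNIV. x $ i)"
      "\<And>i. 0 \<le> x $ i + (real t - (\<Sum>i\<in>UNIV. x $ i)) * real (q i) / real N"
      using x by (auto simp: dilate)
    define m where "m = nat (int t - (\<Sum>i\<in>UNIV. z i))"
    have m: "int m = int t - (\<Sum>i\<in>UNIV. z i)"
      using H(1) unfolding sx m_def by (simp only: of_int_0_le_iff)
    \<comment> \<open>Integrality of \<open>z i\<close> allows the rational bound to be replaced by
      its floor.\<close>
    have pos: "0 \<le> z i + int (m * q i div N)" for i
    proof -
      have "of_int (- z i) \<le> real (m * q i) / real N"
        using H(2)[of i] unfolding sx m[symmetric] by (simp add: z)
      then have "- z i \<le> \<lfloor>real (m * q i) / real N\<rfloor>"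
        by (simp only: le_floor_iff)
      then show ?thesis by (simp add: floor_divide_of_nat_eq del: of_nat_mult)
    qed
    define f where "f = case_option (m div N) (\<lambda>i. nat (z i + int (m * q i div N)))"
    define b where "b = m mod N"
    have bN: "b < N" using N by (simp add: b_def)
    have mb: "b + f None * N = m" by (simp add: b_def f_def)
    have fS: "int (f (Some i)) = z i + int (m * q i div N)" for i
      using pos[of i] by (simp add: f_def)
    have "int (w b + sum f UNIV) = int t"
    proof -
      have "int (\<Sum>i\<in>UNIV. f (Some i)) = (\<Sum>i\<in>UNIV. z i) + int (\<Sum>i\<in>UNIV. m * q i div N)"
        by (simp only: of_nat_sum fS sum.distrib)
      then show ?thesis
        using floors[OF bN, of "f None", THEN arg_cong[of _ _ int], unfolded mb] m
        unfolding split by (simp del: of_nat_sum of_nat_mult)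
    qed
    then have "(b, f) \<in> C"
      using bN by (simp add: C_def del: of_nat_add of_nat_sum)
    moreover have "x = \<Phi> (b, f)"
    proof -
      have "x $ i = real (f (Some i)) - real (m * q i div N)" for i
        using fS[of i, THEN arg_cong[of _ _ real_of_int]] by (simp add: z)
      then show ?thesis by (simp add: \<Phi>_def vec_eq_iff mb)
    qed
    ultimately show "x \<in> \<Phi> ` C" by blast
  qed
  then have "card ((\<lambda>x. real t *\<^sub>R x) ` weight_simplex q \<inter> integer_points) = card C"
    by (simp add: card_image inj)
  also have fib: "{f :: 'n option \<Rightarrow> nat. w b + sum f UNIV = t}
      = (if w b \<le> t then weak_compositions UNIV (t - w b) else {})" for b
    by (auto simp: weak_compositions_def)
  have "card C = (\<Sum>b<N. card {f :: 'n option \<Rightarrow> nat. w b + sum f UNIV = t})"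
    unfolding C_def by (intro card_SigmaI) (auto simp: fib finite_weak_compositions)
  also have "\<dots> = (\<Sum>b<N. if w b \<le> t then card (weak_compositions (UNIV :: 'n option set) (t - w b)) else 0)"
    by (intro sum.cong refl) (simp add: fib)
  finally show ?thesis .
qed

text \<open>Each residue \<open>b\<close> contributes the series of weak compositions into
  \<open>CARD('n) + 1\<close> parts, shifted by \<open>w b\<close>. Multiplication by the
  denominator leaves \<open>fps_X ^ w b\<close>. The bound \<open>w_le\<close> supplies the degree
  condition of \<open>hstar_poly_eqI\<close>.\<close>

lemma hstar_weight_simplex:
  fixes q :: "'n::finite \<Rightarrow> nat"
  defines "N \<equiv> 1 + (\<Sum>i\<in>UNIV. q i)"
  assumes w: "\<And>b. b < N \<Longrightarrow> (\<Sum>i\<in>UNIV. b * q i div N) + w b = b"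
    and w_le: "\<And>b. b < N \<Longrightarrow> w b \<le> CARD('n)"
  shows "hstar_poly (weight_simplex q) = (\<Sum>b<N. monom 1 (w b))"
proof (rule hstar_poly_eqI)
  let ?h = "\<Sum>b<N. monom 1 (w b) :: real poly"
  show "degree ?h \<le> nat (aff_dim (weight_simplex q))"
    by (intro degree_sum_le) (auto simp: aff_dim_weight_simplex degree_monom_eq w_le)
  let ?G = "Abs_fps (\<lambda>s. of_nat (card (weak_compositions (UNIV :: 'n option set) s))) :: real fps"
  let ?u = "(1 - fps_X) ^ (nat (aff_dim (weight_simplex q)) + 1) :: real fps"
  have u: "?G * ?u = 1"
    using fps_weak_compositions[of "UNIV :: 'n option set"] by (simp add: aff_dim_weight_simplex)
  have "ehrhart_series (weight_simplex q) = (\<Sum>b<N. fps_X ^ w b * ?G)"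
    using card_lattice_points_weight_simplex[of q w, folded N_def, OF w]
    by (auto simp: fps_eq_iff ehrhart_series_def fps_sum_nth fps_X_power_mult_nth intro!: sum.cong)
  also have "\<dots> = fps_of_poly ?h * ?G"
    by (simp add: fps_of_poly_sum fps_of_poly_monom sum_distrib_right)
  finally have "ehrhart_series (weight_simplex q) * ?u = fps_of_poly ?h"
    by (simp only: mult.assoc u mult_1_right)
  moreover have "?u \<noteq> 0" using u by auto
  ultimately show "ehrhart_series (weight_simplex q) = fps_of_poly ?h / ?u"
    by (metis nonzero_mult_div_cancel_right)
qed

section \<open>Specialisation to base \<open>r\<close>\<close>

theorem theorem4p1:
  fixes r n :: nat and idx :: "'n::finite \<Rightarrow> nat"
  assumes "r \<ge> 2" and "n \<ge> 1"
    and "bij_betw idx UNIV {1..n}"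
  shows "hstar_poly (base_simplex r idx) = (\<Sum>b = 0..r ^ n - 1. monom 1 (nasc r b))"
proof -
  define q where "q i = (r - 1) * r ^ (idx i - 1)" for i
  have card: "CARD('n) = n"
    using bij_betw_same_card[OF assms(3)] by simp
  \<comment> \<open>The order of coordinates is reversed: cancelling \<open>r ^ (idx i - 1)\<close>
    in \<open>q i / r ^ n\<close> leaves \<open>(r - 1) / r ^ Suc j\<close> with
    \<open>j = n - idx i\<close>.\<close>
  have bij: "bij_betw (\<lambda>i. n - idx i) UNIV {..<n}"
  proof -
    have "bij_betw (\<lambda>k. n - k) {1..n} {..<n}"
      by (rule bij_betw_byWitness[where f' = "\<lambda>k. n - k"]) (use assms(2) in auto)
    from bij_betw_trans[OF assms(3) this] show ?thesis by (simp add: o_def)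
  qed
  have idx: "1 \<le> idx i" "idx i \<le> n" for i
    using bij_betw_apply[OF assms(3), of i] by auto
  have "(\<Sum>i\<in>UNIV. q i) = (\<Sum>k = 1..n. (r - 1) * r ^ (k - 1))"
    unfolding q_def using assms(3) by (rule sum.reindex_bij_betw)
  also have "\<dots> = (\<Sum>k<n. (r - 1) * r ^ k)"
    by (rule sum.reindex_bij_witness[of _ Suc "\<lambda>k. k - 1"]) auto
  \<comment> \<open>The geometric sum yields \<open>N = r ^ n\<close>, so the residues are exactly
    the numbers with at most \<open>n\<close> digits.\<close>
  also have "1 + \<dots> = r ^ n"
    using assms(1)
  proof (induction n)
    case (Suc n)
    then show ?case by (cases r) (auto simp: algebra_simps)
  qed simp
  finally have N: "1 + (\<Sum>i\<in>UNIV. q i) = r ^ n" by simp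
  have floors: "(\<Sum>i\<in>UNIV. b * q i div r ^ n) + nasc r b = b" if "b < r ^ n" for b
  proof -
    have "b * q i div r ^ n = b * (r - 1) div r ^ Suc (n - idx i)" for i
    proof -
      have "r ^ n = r ^ Suc (n - idx i) * r ^ (idx i - 1)"
        using idx[of i] by (simp flip: power_add power_Suc)
      then show ?thesis
        using assms(1) by (simp add: q_def flip: mult.assoc del: power_Suc)
    qed
    then have "(\<Sum>i\<in>UNIV. b * q i div r ^ n) = (\<Sum>j<n. b * (r - 1) div r ^ Suc j)"
      using sum.reindex_bij_betw[OF bij, of "\<lambda>j. b * (r - 1) div r ^ Suc j"] by simp
    then show ?thesis using sum_div_power_plus_nasc[OF assms(1) that] by simp
  qed
  have le: "nasc r b \<le> CARD('n)" if "b < r ^ n" for b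
    using card_mono[OF _ Nasc_subset[OF assms(1) that]] by (simp add: card nasc_def)
  have "base_simplex r idx = weight_simplex q"
    using assms(1)
    by (simp add: base_simplex_def weight_simplex_def base_simplex_q_def q_def of_nat_diff)
  also have "hstar_poly \<dots> = (\<Sum>b<r ^ n. monom 1 (nasc r b))"
    using hstar_weight_simplex[of q "nasc r"] floors le unfolding N by blast
  also have "{..<r ^ n} = {0..r ^ n - 1}"
    using assms(1) by (auto simp: Suc_le_eq[symmetric] le_diff_conv2)
  finally show ?thesis .
qed

end
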